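(* Let $(\mathbf{x}_i,\hat y_i,y_i^* )$, $i=1,\dots,N$, be i.i.d. calibration samples from a distribution $\mathcal{D}$ on $\mathcal{X}\times\mathcal{Y}\times\mathcal{Y}$, let $\delta\in(0,1)$, and let $(t_1,t_2)\in\mathbb{R}^2$ be a fixed threshold pair with $\Pr(I=1)>0$. With the selection indicator $I$, the true false discovery rate $R(t_1,t_2)$ and the Clopper--Pearson upper bound $\hat R^{\mathrm{upper}}_{1-\delta}(t_1,t_2)$ of the two-mode routing policy defined in the context, $$\Pr\Big(R(t_1,t_2)\le \hat R^{\mathrm{upper}}_{1-\delta}(t_1,t_2)\Big)\ge 1-\delta,$$ where the probability is over the calibration samples.
   Context: $\mathcal{X}$ (questions) and $\mathcal{Y}$ (answers) are measurable spaces. A sample is a triple $(\mathbf{x},\hat y,y^* )$ consisting of a question, a candidate answer and a ground-truth answer. The ground-truth evaluation label $e^*\in\{0,1\}$ is a (measurable) function of $(\mathbf{x},\hat y,y^* )$. For each instance there are two evaluation modes. Mode $k\in\{1,2\}$ produces a verdict $v_k\in\{0,1\}$ and a real-valued uncertainty score $U_k$. Mode 1 uses $(\mathbf{x},\hat y)$ only; Mode 2 also uses retrieved evidence, which is itself determined by the input. Thus $v_1,U_1,v_2,U_2$ are all fixed (measurable, deterministic) functions of $(\mathbf{x},\hat y)$. The correctness indicator of mode $k$ is $c_k=\mathbf{1}[v_k=e^*]$. Routing policy with thresholds $(t_1,t_2)$: output $v_1$ if $U_1\le t_1$; output $v_2$ if $U_1>t_1$ and $U_2\le t_2$; otherwise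 abstain. The selection indicator is $I=\mathbf{1}\{U_1\le t_1\}+\mathbf{1}\{U_1>t_1 \text{ and } U_2\le t_2\}\in\{0,1\}$. The correctness of the output verdict is $c=\mathbf{1}\{U_1\le t_1\}\,c_1+\mathbf{1}\{U_1>t_1\text{ and }U_2\le t_2\}\,c_2$, and the failure indicator is $W=1-c$. The true false discovery rate is $R(t_1,t_2)=\mathbb{E}[W\mid I=1]$ for a generic draw from $\mathcal{D}$. Write a superscript or subscript $i$ for evaluation at the $i$-th calibration sample. The selection size is $\hat m_{\mathrm{cal}}=\hat m_{\mathrm{cal}}(t_1,t_2)=\sum_{i=1}^N I_i$, and the error count is $$\hat w_{\mathrm{cal}}=\hat w_{\mathrm{cal}}(t_1,t_2)=\sum_{i=1}^N\Big[\mathbf{1}\{U_1^{(i)}\le t_1\}(1-c_1^{(i)})+\mathbf{1}\{U_1^{(i)}>t_1\text{ and }U_2^{(i)}\le t_2\}(1-c_2^{(i)})\Big].$$ The Clopper--Pearson upper bound is $$\hat R^{\mathrm{upper}}_{1-\delta}(t_1,t_2)=\mathrm{BetaInv}\big(1-\delta;\ \hat w_{\mathrm{cal}}+1,\ \hat m_{\mathrm{cal}}-\hat w_{\mathrm{cal}}\big),$$ where $\mathrm{BetaInv}(q;a,b)$ is the $q$-quantile of the $\mathrm{Beta}(a,b)$ distribution. Equivalently, $\hat R^{\mathrm{upper}}_{1-\delta}(t_1,t_2)=\sup\{r\in[0,1]:\Pr(\mathrm{Binomial}(\hat m_{\mathrm{cal}},r)\le \hat w_{\mathrm{cal}})\ge\delta\}$.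 When $\hat w_{\mathrm{cal}}=\hat m_{\mathrm{cal}}$ (including $\hat m_{\mathrm{cal}}=0$), the bound equals $1$ by convention, in agreement with this supremum. *)

theory Defs
  imports "HOL-Probability.Probability"
begin

text \<open>
  Samples are triples \<open>(x, yh, ys)\<close>: question, candidate answer, ground-truth answer. Verdicts and
  evaluation labels in \<open>{0,1}\<close> are rendered as \<^typ>\<open>bool\<close>; indicators and counts are real-valued,
  so that differences are not truncated.
\<close>

definition correct :: "('x \<times> 'y \<Rightarrow> bool) \<Rightarrow> ('x \<times> 'y \<times> 'y \<Rightarrow> bool) \<Rightarrow> 'x \<times> 'y \<times> 'y \<Rightarrow> real" where
  "correct v e = (\<lambda>(x, yh, ys). of_bool (v (x, yh) = e (x, yh, ys)))"

definition use_mode1 :: "('x \<times> 'y \<Rightarrow> real) \<Rightarrow> real \<Rightarrow> 'x \<times> 'y \<times> 'y \<Rightarrow> real" where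
  "use_mode1 U1 t1 = (\<lambda>(x, yh, ys). of_bool (U1 (x, yh) \<le> t1))"

definition use_mode2 ::
    "('x \<times> 'y \<Rightarrow> real) \<Rightarrow> ('x \<times> 'y \<Rightarrow> real) \<Rightarrow> real \<Rightarrow> real \<Rightarrow> 'x \<times> 'y \<times> 'y \<Rightarrow> real" where
  "use_mode2 U1 U2 t1 t2 = (\<lambda>(x, yh, ys). of_bool (U1 (x, yh) > t1 \<and> U2 (x, yh) \<le> t2))"

definition selection ::
    "('x \<times> 'y \<Rightarrow> real) \<Rightarrow> ('x \<times> 'y \<Rightarrow> real) \<Rightarrow> real \<Rightarrow> real \<Rightarrow> 'x \<times> 'y \<times> 'y \<Rightarrow> real" where
  "selection U1 U2 t1 t2 s = use_mode1 U1 t1 s + use_mode2 U1 U2 t1 t2 s"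

definition output_correct ::
    "('x \<times> 'y \<Rightarrow> bool) \<Rightarrow> ('x \<times> 'y \<Rightarrow> bool) \<Rightarrow> ('x \<times> 'y \<times> 'y \<Rightarrow> bool) \<Rightarrow>
     ('x \<times> 'y \<Rightarrow> real) \<Rightarrow> ('x \<times> 'y \<Rightarrow> real) \<Rightarrow> real \<Rightarrow> real \<Rightarrow> 'x \<times> 'y \<times> 'y \<Rightarrow> real" where
  "output_correct v1 v2 e U1 U2 t1 t2 s =
     use_mode1 U1 t1 s * correct v1 e s + use_mode2 U1 U2 t1 t2 s * correct v2 e s"

definition failure ::
    "('x \<times> 'y \<Rightarrow> bool) \<Rightarrow> ('x \<times> 'y \<Rightarrow> bool) \<Rightarrow> ('x \<times> 'y \<times> 'y \<Rightarrow> bool) \<Rightarrow>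
     ('x \<times> 'y \<Rightarrow> real) \<Rightarrow> ('x \<times> 'y \<Rightarrow> real) \<Rightarrow> real \<Rightarrow> real \<Rightarrow> 'x \<times> 'y \<times> 'y \<Rightarrow> real" where
  "failure v1 v2 e U1 U2 t1 t2 s = 1 - output_correct v1 v2 e U1 U2 t1 t2 s"

text \<open>
  \<open>E[W | I = 1]\<close>: \<^const>\<open>uniform_measure\<close> \<open>D A\<close> is the conditional distribution of \<open>D\<close> given
  the event \<open>A\<close> (for arbitrary \<open>D\<close>, despite the name).
\<close>

definition true_FDR ::
    "('x \<times> 'y \<times> 'y) measure \<Rightarrow> ('x \<times> 'y \<Rightarrow> bool) \<Rightarrow> ('x \<times> 'y \<Rightarrow> bool) \<Rightarrow>
     ('x \<times> 'y \<times> 'y \<Rightarrow> bool) \<Rightarrow> ('x \<times> 'y \<Rightarrow> real) \<Rightarrow> ('x \<times> 'y \<Rightarrow> real) \<Rightarrow> real \<Rightarrow> real \<Rightarrow> real" where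
  "true_FDR D v1 v2 e U1 U2 t1 t2 =
     (LINT s | uniform_measure D {s \<in> space D. selection U1 U2 t1 t2 s = 1}.
        failure v1 v2 e U1 U2 t1 t2 s)"

definition selection_size ::
    "nat \<Rightarrow> (nat \<Rightarrow> 'x \<times> 'y \<times> 'y) \<Rightarrow> ('x \<times> 'y \<Rightarrow> real) \<Rightarrow> ('x \<times> 'y \<Rightarrow> real) \<Rightarrow> real \<Rightarrow> real \<Rightarrow> real" where
  "selection_size N z U1 U2 t1 t2 = (\<Sum>i=1..N. selection U1 U2 t1 t2 (z i))"

definition error_count ::
    "nat \<Rightarrow> (nat \<Rightarrow> 'x \<times> 'y \<times> 'y) \<Rightarrow> ('x \<times> 'y \<Rightarrow> bool) \<Rightarrow> ('x \<times> 'y \<Rightarrow> bool) \<Rightarrow>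
     ('x \<times> 'y \<times> 'y \<Rightarrow> bool) \<Rightarrow> ('x \<times> 'y \<Rightarrow> real) \<Rightarrow> ('x \<times> 'y \<Rightarrow> real) \<Rightarrow> real \<Rightarrow> real \<Rightarrow> real" where
  "error_count N z v1 v2 e U1 U2 t1 t2 =
     (\<Sum>i=1..N. use_mode1 U1 t1 (z i) * (1 - correct v1 e (z i))
             + use_mode2 U1 U2 t1 t2 (z i) * (1 - correct v2 e (z i)))"

definition beta_density :: "real \<Rightarrow> real \<Rightarrow> real \<Rightarrow> real" where
  "beta_density a b x =
     indicator {0<..<1} x * (x powr (a - 1) * (1 - x) powr (b - 1) / Beta a b)"

definition beta_measure :: "real \<Rightarrow> real \<Rightarrow> real measure" where
  "beta_measure a b = density lborel (\<lambda>x. ennreal (beta_density a b x))"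

definition quantile :: "real measure \<Rightarrow> real \<Rightarrow> real" where
  "quantile M q = Inf {x. q \<le> cdf M x}"

definition BetaInv :: "real \<Rightarrow> real \<Rightarrow> real \<Rightarrow> real" where
  "BetaInv q a b = quantile (beta_measure a b) q"

text \<open>\<open>Beta(w + 1, 0)\<close> does not exist, so \<open>w = m\<close> is given the conventional value 1.\<close>

definition clopper_pearson_upper :: "real \<Rightarrow> real \<Rightarrow> real \<Rightarrow> real" where
  "clopper_pearson_upper \<delta> w m = (if w = m then 1 else BetaInv (1 - \<delta>) (w + 1) (m - w))"

definition R_upper ::
    "real \<Rightarrow> nat \<Rightarrow> (nat \<Rightarrow> 'x \<times> 'y \<times> 'y) \<Rightarrow> ('x \<times> 'y \<Rightarrow> bool) \<Rightarrow> ('x \<times> 'y \<Rightarrow> bool) \<Rightarrow>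
     ('x \<times> 'y \<times> 'y \<Rightarrow> bool) \<Rightarrow> ('x \<times> 'y \<Rightarrow> real) \<Rightarrow> ('x \<times> 'y \<Rightarrow> real) \<Rightarrow> real \<Rightarrow> real \<Rightarrow> real" where
  "R_upper \<delta> N z v1 v2 e U1 U2 t1 t2 =
     clopper_pearson_upper \<delta> (error_count N z v1 v2 e U1 U2 t1 t2)
       (selection_size N z U1 U2 t1 t2)"

end

theory Submission
  imports Defs
begin

text \<open>
  A sample is selected with probability \<open>p\<close> and is a selected error with probability \<open>p r\<close>, where
  \<open>r\<close> is the true false discovery rate. By independence, the index sets \<open>J\<close> of selected
  samples and \<open>K \<subseteq> J\<close> of errors have probability
  \<open>p^|J| (1 - p)^(N - |J|) r^|K| (1 - r)^(|J| - |K|)\<close>, so given \<open>J\<close> the error count is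
  \<open>Binomial(|J|, r)\<close>. Since the \<open>Beta(w + 1, m - w)\<close> distribution function at \<open>r\<close> is the
  probability that a \<open>Binomial(m, r)\<close> variable exceeds \<open>w\<close>, the Clopper--Pearson bound can only
  fall below \<open>r\<close> when \<open>Pr(Binomial(m, r) \<le> w) \<le> \<delta>\<close>. For each fixed \<open>m\<close> the counts \<open>w\<close>
  with this property form an initial segment of binomial probability at most \<open>\<delta>\<close>; averaging
  over \<open>J\<close> gives the claim.
\<close>

section \<open>Binomial distribution functions as polynomials in the success probability\<close>

text \<open>A polynomial in every real \<open>x\<close>, hence differentiable at 0 and 1 as well.
  For \<open>j > m\<close> the truncated exponent \<open>m - j\<close> is harmless because
  \<open>m choose j\<close> is 0.\<close>

definition binomial_cdf :: "nat \<Rightarrow> real \<Rightarrow> nat \<Rightarrow> real" where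
  "binomial_cdf m x w = (\<Sum>j\<le>w. real (m choose j) * x ^ j * (1 - x) ^ (m - j))"

lemma binomial_cdf_Suc:
  "binomial_cdf m x (Suc w) =
     binomial_cdf m x w + real (m choose Suc w) * x ^ Suc w * (1 - x) ^ (m - Suc w)"
  by (simp add: binomial_cdf_def)

text \<open>Differentiating termwise telescopes: contributions of adjacent terms cancel and only one
  from the last term survives. On (0,1) it is minus the density of Beta(w + 1, m - w).\<close>

lemma DERIV_binomial_cdf:
  assumes "w < m"
  shows "((\<lambda>x. binomial_cdf m x w) has_real_derivative
            - (real (m - w) * real (m choose w) * x ^ w * (1 - x) ^ (m - Suc w))) (at x)"
  using assms
proof (induction w)
  case 0
  then show ?case
    unfolding binomial_cdf_def by (auto intro!: derivative_eq_intros)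
next
  case (Suc w)
  let ?c = "real (m choose Suc w)"
  \<comment> \<open>By this identity the derivative of the earlier sum cancels against the part of
    the new term that comes from \<open>x ^ Suc w\<close>.\<close>
  have "Suc w * (m choose Suc w) = (m - w) * (m choose w)"
    using Suc.prems by (simp add: binomial_absorption binomial_absorb_comp del: mult_Suc)
  then have absorb: "real (m - w) * real (m choose w) = real (Suc w) * ?c"
    by (metis of_nat_mult)
  have "((\<lambda>x. (1 - x) ^ (m - Suc w)) has_real_derivative
          - (real (m - Suc w) * (1 - x) ^ (m - Suc (Suc w)))) (at x)"
    by (auto intro!: derivative_eq_intros)
  moreover have "((\<lambda>x. x ^ Suc w) has_real_derivative real (Suc w) * x ^ w) (at x)"
    using DERIV_pow[of "Suc w" x] by simp
  ultimately have "((\<lambda>x. binomial_cdf m x w + ?c * (x ^ Suc w * (1 - x) ^ (m - Suc w))) has_real_derivative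
          - (real (m - w) * real (m choose w) * x ^ w * (1 - x) ^ (m - Suc w))
          + ?c * (real (Suc w) * x ^ w * (1 - x) ^ (m - Suc w)
                  + - (real (m - Suc w) * (1 - x) ^ (m - Suc (Suc w))) * x ^ Suc w)) (at x)"
    using Suc by (intro DERIV_add DERIV_cmult DERIV_mult) auto
  then show ?case
    unfolding binomial_cdf_Suc absorb by (simp add: algebra_simps)
qed

lemma binomial_cdf_at_0: "binomial_cdf m 0 w = 1"
  by (induction w) (auto simp: binomial_cdf_def)

lemma binomial_cdf_at_1: "w < m \<Longrightarrow> binomial_cdf m 1 w = 0"
  by (auto simp: binomial_cdf_def intro!: sum.neutral)

lemma binomial_cdf_antimono:
  assumes "w < m" "0 \<le> x" "x \<le> y" "y \<le> 1"
  shows "binomial_cdf m y w \<le> binomial_cdf m x w"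
  using assms(3)
proof (rule DERIV_nonpos_imp_nonincreasing)
  fix z assume z: "x \<le> z" "z \<le> y"
  show "\<exists>d. ((\<lambda>x. binomial_cdf m x w) has_real_derivative d) (at z) \<and> d \<le> 0"
    using DERIV_binomial_cdf[OF assms(1), of z] z assms
    by (intro exI[of _ "- (real (m - w) * real (m choose w) * z ^ w * (1 - z) ^ (m - Suc w))"]) auto
qed

section \<open>Beta distributions with integer parameters\<close>

text \<open>Gamma at positive integers is a factorial, so the Beta value is w! (m - w - 1)! / m!.
  Its inverse is the constant in \<open>DERIV_binomial_cdf\<close>.\<close>

lemma inverse_Beta_nat:
  assumes "w < m"
  shows "1 / Beta (real w + 1) (real m - real w) = real (m - w) * real (m choose w)"
proof -
  obtain k where m: "m = Suc (w + k)"
    using assms less_iff_Suc_add by auto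
  have "Beta (real w + 1) (real m - real w) = fact w * fact k / fact m"
    using Gamma_fact[of w, where 'a=real] Gamma_fact[of k, where 'a=real] Gamma_fact[of m, where 'a=real]
    by (simp add: Beta_def m add_ac)
  moreover have "real (m choose w) = fact m / (fact w * fact (m - w))"
    using assms by (intro binomial_fact) auto
  moreover have "m - w = Suc k" by (simp add: m)
  ultimately show ?thesis
    by (simp del: of_nat_Suc)
qed

lemma beta_density_nat:
  assumes "w < m" "0 < x" "x < 1"
  shows "beta_density (real w + 1) (real m - real w) x =
           real (m - w) * real (m choose w) * x ^ w * (1 - x) ^ (m - Suc w)"
proof -
  have "real m - real w - 1 = real (m - Suc w)"
    using assms by (simp add: of_nat_diff)
  then have "(1 - x) powr (real m - real w - 1) = (1 - x) ^ (m - Suc w)"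
    using assms by (simp only: powr_realpow)
  then have "beta_density (real w + 1) (real m - real w) x =
      x ^ w * (1 - x) ^ (m - Suc w) * (1 / Beta (real w + 1) (real m - real w))"
    using assms by (simp add: beta_density_def powr_realpow)
  then show ?thesis
    unfolding inverse_Beta_nat[OF assms(1)] by simp
qed

text \<open>Beta-binomial duality by the fundamental theorem of calculus:
  \<open>- binomial_cdf\<close> is an antiderivative of the density, with value -1 at 0.\<close>

lemma emeasure_beta_measure_atMost:
  assumes "w < m" "0 \<le> r" "r \<le> 1"
  shows "emeasure (beta_measure (real w + 1) (real m - real w)) {..r} =
           ennreal (1 - binomial_cdf m r w)"
proof -
  define g where "g x = real (m - w) * real (m choose w) * x ^ w * (1 - x) ^ (m - Suc w)" for x
  have "emeasure (beta_measure (real w + 1) (real m - real w)) {..r} =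
      (\<integral>\<^sup>+x. ennreal (beta_density (real w + 1) (real m - real w) x) * indicator {..r} x \<partial>lborel)"
    unfolding beta_measure_def
    by (intro emeasure_density) (auto simp: beta_density_def[abs_def])
  \<comment> \<open>The density vanishes at 0 and 1 and \<open>0 powr 0 = 0\<close>, so it agrees with \<open>g\<close> only almost everywhere.\<close>
  also have "\<dots> = (\<integral>\<^sup>+x. ennreal (g x) * indicator {0..r} x \<partial>lborel)"
  proof (rule nn_integral_cong_AE)
    show "AE x in lborel. ennreal (beta_density (real w + 1) (real m - real w) x) * indicator {..r} x
            = ennreal (g x) * indicator {0..r} x"
      using AE_lborel_singleton[of 0] AE_lborel_singleton[of 1]
    proof eventually_elim
      case (elim x)
      then show ?case
        using beta_density_nat[OF assms(1), of x] assms
        by (cases "0 < x \<and> x < 1") (auto simp: g_def indicator_def beta_density_def)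
    qed
  qed
  also have "\<dots> = ennreal (- binomial_cdf m r w - - binomial_cdf m 0 w)"
  proof (rule nn_integral_FTC_Icc)
    show "g \<in> borel_measurable borel" unfolding g_def by measurable
    show "((\<lambda>x. - binomial_cdf m x w) has_real_derivative g x) (at x)" for x
      using DERIV_minus[OF DERIV_binomial_cdf[OF assms(1), of x]] by (simp add: g_def)
    show "0 \<le> g x" if "x \<in> {0..r}" for x
      using that assms by (auto simp: g_def)
  qed (use assms in auto)
  finally show ?thesis by (simp add: binomial_cdf_at_0)
qed

lemma cdf_beta_measure:
  assumes "w < m" "0 \<le> r" "r \<le> 1"
  shows "cdf (beta_measure (real w + 1) (real m - real w)) r = 1 - binomial_cdf m r w"
  using emeasure_beta_measure_atMost[OF assms] binomial_cdf_antimono[OF assms(1), of 0 r] assms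
  by (simp add: cdf_def measure_def binomial_cdf_at_0)

text \<open>Keeps negative numbers out of the set whose infimum is a quantile of positive level, so
  that \<open>binomial_cdf_antimono\<close> applies to its members.\<close>

lemma cdf_beta_measure_neg:
  assumes "r < 0"
  shows "cdf (beta_measure a b) r = 0"
proof -
  have "emeasure (beta_measure a b) {..r} =
      (\<integral>\<^sup>+x. ennreal (beta_density a b x) * indicator {..r} x \<partial>lborel)"
    unfolding beta_measure_def
    by (intro emeasure_density) (auto simp: beta_density_def[abs_def])
  also have "\<dots> = (\<integral>\<^sup>+x. 0 \<partial>(lborel :: real measure))"
    using assms by (intro nn_integral_cong) (auto simp: beta_density_def indicator_def)
  finally show ?thesis by (simp add: cdf_def measure_def)
qed

section \<open>Undercoverage and binomial lower tails\<close>

text \<open>A quantile below \<open>r\<close> yields some \<open>x < r\<close> where the Beta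
  distribution function is at least \<open>1 - \<delta>\<close>. By duality the binomial one is at
  most \<open>\<delta>\<close> at \<open>x\<close>, and it decreases towards
  \<open>r\<close>.\<close>

lemma clopper_pearson_upper_less_imp:
  assumes "w \<le> m" "r \<le> 1" "0 < \<delta>" "\<delta> < 1"
    and less: "clopper_pearson_upper \<delta> (real w) (real m) < r"
  shows "binomial_cdf m r w \<le> \<delta>"
proof -
  \<comment> \<open>The conventional value 1 cannot lie below \<open>r \<le> 1\<close>.\<close>
  have "w \<noteq> m" using less assms by (auto simp: clopper_pearson_upper_def)
  with assms have wm: "w < m" by simp
  let ?M = "beta_measure (real w + 1) (real m - real w)"
  \<comment> \<open>The point 1 makes the set nonempty, so an infimum below \<open>r\<close>
    produces a member below \<open>r\<close>.\<close>
  have "cdf ?M 1 = 1"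
    using wm by (simp add: cdf_beta_measure binomial_cdf_at_1)
  then have ne: "{x. 1 - \<delta> \<le> cdf ?M x} \<noteq> {}"
    using assms by (auto intro!: exI[of _ 1])
  have lt: "Inf {x. 1 - \<delta> \<le> cdf ?M x} < r"
    using less wm by (simp add: clopper_pearson_upper_def BetaInv_def quantile_def)
  from cInf_lessD[OF ne lt] obtain x where x: "1 - \<delta> \<le> cdf ?M x" "x < r"
    by auto
  have "0 \<le> x"
    using x(1) cdf_beta_measure_neg[of x "real w + 1" "real m - real w"] assms(4)
    by (cases "x < 0") simp_all
  then show ?thesis
    using x wm assms cdf_beta_measure[of w m x] binomial_cdf_antimono[of w m x r] by simp
qed

text \<open>All indices lie below the largest one, so the sum is at most the distribution function
  there; that index belongs to the set itself.\<close>

lemma binomial_lower_tail_le: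
  assumes "0 \<le> r" "r \<le> 1" "0 \<le> \<delta>"
  shows "(\<Sum>k | k \<le> m \<and> binomial_cdf m r k \<le> \<delta>. real (m choose k) * r ^ k * (1 - r) ^ (m - k)) \<le> \<delta>"
proof (cases "{k. k \<le> m \<and> binomial_cdf m r k \<le> \<delta>} = {}")
  case True
  show ?thesis unfolding True using assms by simp
next
  case False
  let ?T = "{k. k \<le> m \<and> binomial_cdf m r k \<le> \<delta>}"
  have "(\<Sum>k\<in>?T. real (m choose k) * r ^ k * (1 - r) ^ (m - k)) \<le> binomial_cdf m r (Max ?T)"
    unfolding binomial_cdf_def using assms by (intro sum_mono2) auto
  moreover have "Max ?T \<in> ?T" using False by (intro Max_in) auto
  ultimately show ?thesis by auto
qed

text \<open>Grouping the subsets by cardinality supplies the binomial coefficients, which reduces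
  the claim to \<open>binomial_lower_tail_le\<close>.\<close>

lemma binomial_lower_tail_subsets_le:
  assumes "finite J" "0 \<le> r" "r \<le> 1" "0 \<le> \<delta>"
  shows "(\<Sum>K | K \<subseteq> J \<and> binomial_cdf (card J) r (card K) \<le> \<delta>.
            r ^ card K * (1 - r) ^ (card J - card K)) \<le> \<delta>"
proof -
  let ?S = "{K. K \<subseteq> J \<and> binomial_cdf (card J) r (card K) \<le> \<delta>}"
  let ?T = "{k. k \<le> card J \<and> binomial_cdf (card J) r k \<le> \<delta>}"
  have "(\<Sum>K\<in>?S. r ^ card K * (1 - r) ^ (card J - card K)) =
      (\<Sum>k\<in>?T. real (card {K\<in>?S. card K = k}) * (r ^ k * (1 - r) ^ (card J - k)))"
    using assms by (intro sum_fun_comp) (auto intro: card_mono)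
  also have "\<dots> = (\<Sum>k\<in>?T. real (card J choose k) * r ^ k * (1 - r) ^ (card J - k))"
  proof (rule sum.cong[OF refl])
    fix k assume "k \<in> ?T"
    then have "{K\<in>?S. card K = k} = {K. K \<subseteq> J \<and> card K = k}" by auto
    then show "real (card {K\<in>?S. card K = k}) * (r ^ k * (1 - r) ^ (card J - k)) =
        real (card J choose k) * r ^ k * (1 - r) ^ (card J - k)"
      by (simp only: n_subsets[OF assms(1)] mult.assoc)
  qed
  also have "\<dots> \<le> \<delta>" using assms by (intro binomial_lower_tail_le) auto
  finally show ?thesis .
qed


section \<open>Joint law of the selected and the erroneous indices\<close>

context prob_space
begin

context
  fixes M' :: "'b measure" and X :: "'i \<Rightarrow> 'a \<Rightarrow> 'b" and I :: "'i set"
    and Q A :: "'b set" and p r :: real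
  assumes fin: "finite I"
    and indep: "indep_vars (\<lambda>_. M') X I"
    and sets: "Q \<in> sets M'" "A \<in> sets M'" "A \<subseteq> Q"
    and prob_Q: "\<And>i. i \<in> I \<Longrightarrow> prob (X i -` Q \<inter> space M) = p"
    and prob_A: "\<And>i. i \<in> I \<Longrightarrow> prob (X i -` A \<inter> space M) = p * r"
begin

text \<open>Fixing both index sets confines each \<open>X i\<close> to one of the cells
  \<open>A\<close>, \<open>Q - A\<close> and the complement of \<open>Q\<close>, of probabilities p
  r, p (1 - r) and 1 - p. Independence multiplies these.\<close>

lemma selection_pattern_prob:
  assumes "J \<subseteq> I" "K \<subseteq> J"
  shows "{\<omega> \<in> space M. {i\<in>I. X i \<omega> \<in> Q} = J \<and> {i\<in>I. X i \<omega> \<in> A} = K} \<in> events" (is "?E \<in> _")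
    and "prob {\<omega> \<in> space M. {i\<in>I. X i \<omega> \<in> Q} = J \<and> {i\<in>I. X i \<omega> \<in> A} = K} =
           p ^ card J * (1 - p) ^ card (I - J) * (r ^ card K * (1 - r) ^ (card J - card K))"
proof -
  define C where "C i = (if i \<in> K then A else if i \<in> J then Q - A else space M' - Q)" for i
  have rv: "X i \<in> measurable M M'" if "i \<in> I" for i
    using indep that by (auto simp: indep_vars_def)
  have C: "C i \<in> sets M'" for i using sets by (auto simp: C_def)
  have E_eq: "?E = {\<omega> \<in> space M. \<forall>i\<in>I. X i \<omega> \<in> C i}"
  proof (intro set_eqI iffI; clarsimp)
    fix \<omega> i assume "\<omega> \<in> space M" "i \<in> I" "J = {i\<in>I. X i \<omega> \<in> Q}" "K = {i\<in>I. X i \<omega> \<in> A}"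
    then show "X i \<omega> \<in> C i"
      using measurable_space[OF rv[of i], of \<omega>] by (auto simp: C_def)
  next
    fix \<omega> assume "\<omega> \<in> space M" and *: "\<forall>i\<in>I. X i \<omega> \<in> C i"
    have "(X i \<omega> \<in> Q \<longleftrightarrow> i \<in> J) \<and> (X i \<omega> \<in> A \<longleftrightarrow> i \<in> K)" if "i \<in> I" for i
      using *[rule_format, OF that] sets(3) assms(2) by (auto simp: C_def split: if_splits)
    then show "{i\<in>I. X i \<omega> \<in> Q} = J \<and> {i\<in>I. X i \<omega> \<in> A} = K"
      using assms by auto
  qed
  show ev: "?E \<in> events"
    unfolding E_eq using rv C fin by (intro sets.sets_Collect_finite_All) (auto simp: measurable_sets_Collect)
  \<comment> \<open>Written as a selection factor times an error factor, so that the product over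
    \<open>I\<close> splits into the weight of \<open>J\<close> and that of \<open>K\<close> within
    \<open>J\<close>.\<close>
  have prob_C: "prob (X i -` C i \<inter> space M) =
      (if i \<in> J then p else 1 - p) * (if i \<in> J then if i \<in> K then r else 1 - r else 1)"
    if i: "i \<in> I" for i
  proof -
    have Qe: "X i -` Q \<inter> space M \<in> events" and Ae: "X i -` A \<inter> space M \<in> events"
      using rv[OF i] sets by (auto intro: measurable_sets)
    consider "i \<in> K" | "i \<in> J - K" | "i \<notin> J" by auto
    then show ?thesis
    proof cases
      case 1
      then show ?thesis using prob_A[OF i] assms by (auto simp: C_def)
    next
      case 2
      have "X i -` (Q - A) \<inter> space M = (X i -` Q \<inter> space M) - (X i -` A \<inter> space M)" by auto
      then have "prob (X i -` (Q - A) \<inter> space M) = p - p * r"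
        using finite_measure_Diff[OF Qe Ae] prob_A[OF i] prob_Q[OF i] sets(3)
        by (simp only: vimage_mono Int_mono order_refl)
      then show ?thesis using 2 by (auto simp: C_def algebra_simps)
    next
      case 3
      have "X i -` (space M' - Q) \<inter> space M = space M - (X i -` Q \<inter> space M)"
        using measurable_space[OF rv[OF i]] by auto
      then have "prob (X i -` (space M' - Q) \<inter> space M) = 1 - p"
        using prob_compl[OF Qe] prob_Q[OF i] by simp
      then show ?thesis using 3 assms by (auto simp: C_def)
    qed
  qed
  have "prob ?E = (\<Prod>i\<in>I. prob (X i -` C i \<inter> space M))"
  \<comment> \<open>An empty intersection would be the whole type rather than
    \<open>space M\<close>.\<close>
  proof (cases "I = {}")
    case True
    then show ?thesis unfolding E_eq by (simp add: prob_space)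
  next
    case False
    have "?E = (\<Inter>i\<in>I. X i -` C i \<inter> space M)" using False unfolding E_eq by auto
    then show ?thesis using indep_varsD_finite[OF indep False fin, of C] C by simp
  qed
  also have "\<dots> = (\<Prod>i\<in>I. if i \<in> J then p else 1 - p) *
      (\<Prod>i\<in>I. if i \<in> J then if i \<in> K then r else 1 - r else 1)"
    using prob_C by (simp add: prod.distrib[symmetric])
  also have "(\<Prod>i\<in>I. if i \<in> J then p else 1 - p) = p ^ card J * (1 - p) ^ card (I - J)"
    using fin assms by (subst prod.If_cases) (auto simp: Int_absorb1 Diff_eq)
  also have "(\<Prod>i\<in>I. if i \<in> J then if i \<in> K then r else 1 - r else 1) =
      (\<Prod>i\<in>J. if i \<in> K then r else 1 - r)"
    using fin assms by (subst prod.If_cases) (auto simp: Int_absorb1)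
  also have "\<dots> = r ^ card K * (1 - r) ^ card (J - K)"
    using finite_subset[OF assms(1) fin] assms(2)
    by (subst prod.If_cases) (auto simp: Int_absorb1 Diff_eq)
  also have "card (J - K) = card J - card K"
    using finite_subset[OF assms(1) fin] assms(2) by (meson card_Diff_subset finite_subset)
  finally show "prob ?E =
      p ^ card J * (1 - p) ^ card (I - J) * (r ^ card K * (1 - r) ^ (card J - card K))" .
qed

text \<open>The bad event is a finite disjoint union of patterns, hence measurable. For each
  \<open>J\<close> the sum over \<open>K\<close> is at most \<open>\<delta>\<close>, and the weights
  of the sets \<open>J\<close> add up to 1.\<close>

lemma selection_counts_prob_le:
  fixes Bad :: "nat \<Rightarrow> nat \<Rightarrow> bool"
  assumes p: "0 \<le> p" "p \<le> 1" and r: "0 \<le> r" "r \<le> 1" and \<delta>: "0 \<le> \<delta>"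
    and Bad: "\<And>m k. k \<le> m \<Longrightarrow> Bad m k \<Longrightarrow> binomial_cdf m r k \<le> \<delta>"
  shows "{\<omega> \<in> space M. Bad (card {i\<in>I. X i \<omega> \<in> Q}) (card {i\<in>I. X i \<omega> \<in> A})} \<in> events" (is "?B \<in> _")
    and "prob {\<omega> \<in> space M. Bad (card {i\<in>I. X i \<omega> \<in> Q}) (card {i\<in>I. X i \<omega> \<in> A})} \<le> \<delta>"
proof -
  define E where "E = (\<lambda>(J, K). {\<omega> \<in> space M. {i\<in>I. X i \<omega> \<in> Q} = J \<and> {i\<in>I. X i \<omega> \<in> A} = K})"
  define T where "T J = {K. K \<subseteq> J \<and> Bad (card J) (card K)}" for J :: "'i set"
  have fT: "finite (T J)" if "J \<subseteq> I" for J
    using finite_subset[OF that fin] by (auto simp: T_def)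
  have fS: "finite (SIGMA J:Pow I. T J)"
    using fin fT by (intro finite_SigmaI) auto
  have B_eq: "?B = (\<Union>JK\<in>(SIGMA J:Pow I. T J). E JK)"
    using sets(3) by (auto simp: E_def T_def)
  have ev: "E JK \<in> events" if "JK \<in> (SIGMA J:Pow I. T J)" for JK
    using that selection_pattern_prob(1) by (auto simp: E_def T_def)
  show "?B \<in> events"
    unfolding B_eq using fS ev by (intro sets.finite_UN) auto
  have "prob ?B = (\<Sum>JK\<in>(SIGMA J:Pow I. T J). prob (E JK))"
    unfolding B_eq using fS ev
    by (intro finite_measure_finite_Union) (auto simp: disjoint_family_on_def E_def)
  also have "\<dots> = (\<Sum>J\<in>Pow I. \<Sum>K\<in>T J. prob (E (J, K)))"
    using fin fT by (subst sum.Sigma) auto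
  also have "\<dots> = (\<Sum>J\<in>Pow I. p ^ card J * (1 - p) ^ card (I - J) *
      (\<Sum>K\<in>T J. r ^ card K * (1 - r) ^ (card J - card K)))"
    unfolding sum_distrib_left
    by (intro sum.cong refl) (auto simp: E_def T_def selection_pattern_prob(2))
  also have "\<dots> \<le> (\<Sum>J\<in>Pow I. p ^ card J * (1 - p) ^ card (I - J) * \<delta>)"
  proof (intro sum_mono mult_left_mono)
    fix J assume "J \<in> Pow I"
    then have fJ: "finite J" using fin finite_subset by auto
    have "(\<Sum>K\<in>T J. r ^ card K * (1 - r) ^ (card J - card K)) \<le>
        (\<Sum>K | K \<subseteq> J \<and> binomial_cdf (card J) r (card K) \<le> \<delta>.
           r ^ card K * (1 - r) ^ (card J - card K))"
      using fJ r by (intro sum_mono2) (auto simp: T_def intro!: Bad card_mono)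
    also have "\<dots> \<le> \<delta>" using fJ r \<delta> by (intro binomial_lower_tail_subsets_le)
    finally show "(\<Sum>K\<in>T J. r ^ card K * (1 - r) ^ (card J - card K)) \<le> \<delta>" .
  qed (use p in auto)
  \<comment> \<open>Expanding this product over the subsets of \<open>I\<close> gives back the
    weights.\<close>
  also have "\<dots> = (\<Prod>i\<in>I. p + (1 - p)) * \<delta>"
    unfolding prod_add[OF fin] by (simp add: sum_distrib_right)
  finally show "prob ?B \<le> \<delta>" by simp
qed

end

end

section \<open>From the routing policy to selection and error events\<close>

text \<open>The conditional law lives on \<open>Q\<close>, so agreement there suffices. This matters
  because \<open>failure\<close> is 1 on unselected samples and so differs from the indicator of
  selected errors.\<close>

lemma LINT_uniform_measure_indicator:
  fixes f :: "'a \<Rightarrow> real"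
  assumes "prob_space M" "Q \<in> sets M" "A \<in> sets M" "A \<subseteq> Q" "measure M Q > 0"
    and [measurable]: "f \<in> borel_measurable M"
    and f: "\<And>s. s \<in> Q \<Longrightarrow> f s = indicator A s"
  shows "(LINT s | uniform_measure M Q. f s) = measure M A / measure M Q"
proof -
  interpret prob_space M by fact
  have "(LINT s | uniform_measure M Q. f s) = (LINT s | uniform_measure M Q. indicator A s)"
    using assms by (intro integral_cong_AE AE_uniform_measureI) (auto simp: measurable_def)
  also have "\<dots> = measure (uniform_measure M Q) A"
    using assms by simp
  also have "\<dots> = measure M A / measure M Q"
    using assms by (subst measure_uniform_measure) (auto simp: emeasure_eq_measure Int_absorb1)
  finally show ?thesis .
qed

lemma selection_cases: "selection U1 U2 t1 t2 s = 0 \<or> selection U1 U2 t1 t2 s = 1"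
  by (cases s) (simp add: selection_def use_mode1_def use_mode2_def)

lemma failure_cases: "failure v1 v2 e U1 U2 t1 t2 s = 0 \<or> failure v1 v2 e U1 U2 t1 t2 s = 1"
  by (cases s) (auto simp: failure_def output_correct_def use_mode1_def use_mode2_def correct_def)

text \<open>The two modes exclude each other, and for an unselected sample the factor 0 of
  \<open>selection\<close> removes the failure value 1.\<close>

lemma error_term_eq:
  "use_mode1 U1 t1 s * (1 - correct v1 e s) + use_mode2 U1 U2 t1 t2 s * (1 - correct v2 e s) =
     selection U1 U2 t1 t2 s * failure v1 v2 e U1 U2 t1 t2 s"
  by (cases s) (auto simp: selection_def failure_def output_correct_def use_mode1_def use_mode2_def
      correct_def)

theorem mainTheorem2:
  fixes MX :: "'x measure" and MY :: "'y measure"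
    and D :: "('x \<times> 'y \<times> 'y) measure"
    and P :: "'w measure"
    and S :: "nat \<Rightarrow> 'w \<Rightarrow> 'x \<times> 'y \<times> 'y"
    and e :: "'x \<times> 'y \<times> 'y \<Rightarrow> bool"
    and v1 v2 :: "'x \<times> 'y \<Rightarrow> bool"
    and U1 U2 :: "'x \<times> 'y \<Rightarrow> real"
    and N :: nat and \<delta> t1 t2 :: real
  assumes D_prob: "prob_space D"
    and D_sets: "sets D = sets (MX \<Otimes>\<^sub>M MY \<Otimes>\<^sub>M MY)"
    and e_meas: "e \<in> MX \<Otimes>\<^sub>M MY \<Otimes>\<^sub>M MY \<rightarrow>\<^sub>M count_space UNIV"
    and v1_meas: "v1 \<in> MX \<Otimes>\<^sub>M MY \<rightarrow>\<^sub>M count_space UNIV"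
    and v2_meas: "v2 \<in> MX \<Otimes>\<^sub>M MY \<rightarrow>\<^sub>M count_space UNIV"
    and U1_meas: "U1 \<in> MX \<Otimes>\<^sub>M MY \<rightarrow>\<^sub>M borel"
    and U2_meas: "U2 \<in> MX \<Otimes>\<^sub>M MY \<rightarrow>\<^sub>M borel"
    and P_prob: "prob_space P"
    and S_indep: "prob_space.indep_vars P (\<lambda>_. MX \<Otimes>\<^sub>M MY \<Otimes>\<^sub>M MY) S {1..N}"
    and S_distr: "\<And>i. i \<in> {1..N} \<Longrightarrow> distr P (MX \<Otimes>\<^sub>M MY \<Otimes>\<^sub>M MY) (S i) = D"
    and delta: "0 < \<delta>" "\<delta> < 1"
    and sel_pos: "measure D {s \<in> space D. selection U1 U2 t1 t2 s = 1} > 0"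
  shows "measure P {\<omega> \<in> space P.
           true_FDR D v1 v2 e U1 U2 t1 t2
             \<le> R_upper \<delta> N (\<lambda>i. S i \<omega>) v1 v2 e U1 U2 t1 t2} \<ge> 1 - \<delta>"
proof -
  interpret D: prob_space D by (rule D_prob)
  interpret P: prob_space P by (rule P_prob)
  let ?M = "MX \<Otimes>\<^sub>M MY \<Otimes>\<^sub>M MY"
  note [measurable] = e_meas v1_meas v2_meas U1_meas U2_meas
  have spD: "space D = space ?M" using D_sets by (rule sets_eq_imp_space_eq)
  define sel where "sel = selection U1 U2 t1 t2"
  define fl where "fl = failure v1 v2 e U1 U2 t1 t2"
  have sel_meas: "sel \<in> borel_measurable ?M"
    unfolding sel_def selection_def[abs_def] use_mode1_def use_mode2_def by measurable
  have fl_meas: "fl \<in> borel_measurable ?M"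
    unfolding fl_def failure_def[abs_def] output_correct_def use_mode1_def use_mode2_def correct_def
    by measurable
  \<comment> \<open>The policy enters from here on through two events: selection \<open>Q\<close>
    and selected failure \<open>A\<close>.\<close>
  define Q where "Q = {s \<in> space ?M. sel s = 1}"
  define A where "A = {s \<in> space ?M. sel s = 1 \<and> fl s = 1}"
  have Q: "Q \<in> sets ?M" unfolding Q_def using sel_meas by measurable
  have A: "A \<in> sets ?M" unfolding A_def using sel_meas fl_meas by measurable
  have AQ: "A \<subseteq> Q" by (auto simp: A_def Q_def)
  define p where "p = measure D Q"
  define r where "r = measure D A / measure D Q"
  have p_pos: "p > 0" using sel_pos by (simp add: p_def Q_def sel_def spD)
  have A_le: "measure D A \<le> p"
    unfolding p_def using AQ Q D_sets by (intro D.finite_measure_mono) auto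
  have r01: "0 \<le> r" "r \<le> 1" using p_pos A_le by (auto simp: r_def p_def)
  have fl_ind: "fl s = indicator A s" if "s \<in> Q" for s
    using that failure_cases[of v1 v2 e U1 U2 t1 t2 s] by (auto simp: A_def Q_def fl_def)
  have FDR: "true_FDR D v1 v2 e U1 U2 t1 t2 = r"
  proof -
    have "Q = {s \<in> space D. selection U1 U2 t1 t2 s = 1}" by (simp add: Q_def sel_def spD)
    moreover have "fl \<in> borel_measurable D"
      using fl_meas measurable_cong_sets[OF D_sets refl] by blast
    ultimately show ?thesis
      using LINT_uniform_measure_indicator[OF D_prob _ _ AQ _ _ fl_ind] Q A D_sets p_pos
      by (simp add: true_FDR_def fl_def r_def p_def)
  qed
  have rv: "S i \<in> measurable P ?M" if "i \<in> {1..N}" for i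
    using S_indep that by (auto simp: P.indep_vars_def)
  have prob_S: "P.prob (S i -` B \<inter> space P) = measure D B" if "i \<in> {1..N}" "B \<in> sets ?M" for i B
    using measure_distr[OF rv[OF that(1)] that(2)] S_distr[OF that(1)] by simp
  \<comment> \<open>Undercoverage in terms of the two counts; the selection size comes first here,
    the error count first in \<open>clopper_pearson_upper\<close>.\<close>
  define Bad where "Bad m k \<longleftrightarrow> clopper_pearson_upper \<delta> (real k) (real m) < r" for m k :: nat
  let ?B = "{\<omega> \<in> space P. Bad (card {i\<in>{1..N}. S i \<omega> \<in> Q}) (card {i\<in>{1..N}. S i \<omega> \<in> A})}"
  have Bad: "?B \<in> P.events" "P.prob ?B \<le> \<delta>"
  proof -
    have pQ: "P.prob (S i -` Q \<inter> space P) = p" if "i \<in> {1..N}" for i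
      using prob_S[OF that Q] by (simp add: p_def)
    have pA: "P.prob (S i -` A \<inter> space P) = p * r" if "i \<in> {1..N}" for i
      using prob_S[OF that A] p_pos by (simp add: p_def r_def)
    have p01: "0 \<le> p" "p \<le> 1"
      by (simp_all add: p_def)
    have cdf_le: "binomial_cdf m r k \<le> \<delta>" if "k \<le> m" "Bad m k" for m k
      using clopper_pearson_upper_less_imp[of k m r \<delta>] that r01 delta by (simp add: Bad_def)
    note counts = P.selection_counts_prob_le[OF finite_atLeastAtMost S_indep Q A AQ pQ pA
        p01 r01 less_imp_le[OF delta(1)] cdf_le]
    show "?B \<in> P.events" by (rule counts(1))
    show "P.prob ?B \<le> \<delta>" by (rule counts(2))
  qed
  have R_upper: "R_upper \<delta> N (\<lambda>i. S i \<omega>) v1 v2 e U1 U2 t1 t2 =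
      clopper_pearson_upper \<delta> (real (card {i\<in>{1..N}. S i \<omega> \<in> A})) (real (card {i\<in>{1..N}. S i \<omega> \<in> Q}))"
    if \<omega>: "\<omega> \<in> space P" for \<omega>
  proof -
    have card_eq: "real (card {i\<in>{1..N}. S i \<omega> \<in> B}) = (\<Sum>i=1..N. indicator B (S i \<omega>))" for B
      by (simp add: indicator_def sum.If_cases of_bool_def Int_def)
    have sp: "S i \<omega> \<in> space ?M" if "i \<in> {1..N}" for i
      using measurable_space[OF rv[OF that] \<omega>] .
    have "selection U1 U2 t1 t2 s = indicator Q s" if "s \<in> space ?M" for s
      using that selection_cases[of U1 U2 t1 t2 s] by (auto simp: Q_def sel_def)
    then have sel_ind: "selection U1 U2 t1 t2 (S i \<omega>) = indicator Q (S i \<omega>)" if "i \<in> {1..N}" for i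
      using sp[OF that] by blast
    moreover have "selection U1 U2 t1 t2 (S i \<omega>) * failure v1 v2 e U1 U2 t1 t2 (S i \<omega>) =
        indicator A (S i \<omega>)" if "i \<in> {1..N}" for i
      using sel_ind[OF that] fl_ind[of "S i \<omega>"] AQ
      by (cases "S i \<omega> \<in> Q") (auto simp: fl_def indicator_def)
    ultimately show ?thesis
      unfolding R_upper_def error_count_def selection_size_def error_term_eq card_eq
      by (simp only: cong: sum.cong)
  qed
  \<comment> \<open>Coverage is the complement of the measurable event \<open>?B\<close>, so its
    probability is \<open>1 - P.prob ?B\<close>.\<close>
  have "{\<omega> \<in> space P. true_FDR D v1 v2 e U1 U2 t1 t2
          \<le> R_upper \<delta> N (\<lambda>i. S i \<omega>) v1 v2 e U1 U2 t1 t2} = space P - ?B"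
  proof (rule set_eqI)
    fix \<omega>
    show "\<omega> \<in> {\<omega> \<in> space P. true_FDR D v1 v2 e U1 U2 t1 t2
          \<le> R_upper \<delta> N (\<lambda>i. S i \<omega>) v1 v2 e U1 U2 t1 t2} \<longleftrightarrow> \<omega> \<in> space P - ?B"
      using R_upper[of \<omega>] unfolding FDR Bad_def by (cases "\<omega> \<in> space P")
        (simp_all only: mem_Collect_eq Diff_iff not_less simp_thms)
  qed
  then have "measure P {\<omega> \<in> space P. true_FDR D v1 v2 e U1 U2 t1 t2
          \<le> R_upper \<delta> N (\<lambda>i. S i \<omega>) v1 v2 e U1 U2 t1 t2} = 1 - P.prob ?B"
    by (simp only: P.prob_compl[OF Bad(1)])
  then show ?thesis using Bad(2) by linarith
qed

end
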